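(* There are deterministic distributed dynamic data structures for $4$-cycle listing and for $5$-cycle listing which handle edge insertions and deletions in $O(1)$ amortized rounds.
   Context: Highly dynamic network model: a synchronous network on a fixed set $V$ of $n$ nodes with unique identifiers starts as the empty graph; at the beginning of round $i$ the graph is $G_i=(V,E_i)$, obtained from the previous graph by an adversary inserting and/or deleting an arbitrary (unbounded) set of edges. At the start of each round every node is notified only of the insertions/deletions of edges incident to it; then each node may send a message of $O(\log n)$ bits to each of its current neighbors. A distributed dynamic data structure consists of a local part $DS_v$ at each node $v$; at the end of every round, $DS_v$ may be queried and must answer immediately, without any further communication, with $\texttt{true}$, $\texttt{false}$ or $\texttt{inconsistent}$. The amortized round complexity is at most $c$ if for every round $i$, the number of rounds up to round $i$ in which at least one node $v$ has $DS_v$ in an inconsistent state, divided by the total number of topology changes that occurred up to round $i$, is at most $c$. $k$-cycle listing ($k\in\{4,5\}$): in round $i$, $DS_v$ at each node $v$ responds to queries of the form $H=\{v,u_1,\ldots,u_{k-1}\}$ (a cyclically ordered set of $k$ nodes containing $v$) with $\texttt{true}$, $\texttt{false}$ or $\texttt{inconsistent}$, such that if all nodes of $H$ are queried with $H$, then either at least one node responds $\texttt{inconsistent}$, or at least one node responds $\texttt{true}$ if and only if $H$ is a $k$-cycle in $G_{i-1}$. *)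

theory Defs
  imports Complex_Main
begin

text \<open>Highly dynamic network model. Nodes are natural-number identifiers.
  A topology sequence is a function E from round numbers to edge sets; an edge is
  an unordered pair {u,w} of distinct nodes. E 0 is the initial (empty) graph and
  E i is the graph G_i at the beginning of round i (i >= 1).\<close>

datatype answer = Yes | No | Inconsistent

text \<open>A deterministic distributed algorithm. Every function receives n (the number
  of nodes) and the identifier of the executing node. Local states are of type nat list
  (any local data can be encoded). In a round, a node first learns the sets of
  neighbours whose incident edge was inserted / deleted; it then sends to each current
  neighbour a bit string computed from its state and these notifications; finally it
  updates its state from its old state, the notifications and the set of received
  (sender, message) pairs.\<close>

record dalg =
  init  :: "nat \<Rightarrow> nat \<Rightarrow> nat list"
  send  :: "nat \<Rightarrow> nat \<Rightarrow> nat list \<Rightarrow> nat set \<Rightarrow> nat set \<Rightarrow> nat \<Rightarrow> bool list"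
  recv  :: "nat \<Rightarrow> nat \<Rightarrow> nat list \<Rightarrow> nat set \<Rightarrow> nat set \<Rightarrow> (nat \<times> bool list) set \<Rightarrow> nat list"
  query :: "nat \<Rightarrow> nat \<Rightarrow> nat list \<Rightarrow> nat list \<Rightarrow> answer"

definition valid_graph_seq :: "nat set \<Rightarrow> (nat \<Rightarrow> nat set set) \<Rightarrow> bool" where
  "valid_graph_seq V E \<longleftrightarrow> E 0 = {} \<and>
     (\<forall>i. \<forall>e\<in>E i. \<exists>u w. u \<in> V \<and> w \<in> V \<and> u \<noteq> w \<and> e = {u, w})"

text \<open>Notifications received by node v at the start of round Suc i.\<close>
definition ins_nbrs :: "(nat \<Rightarrow> nat set set) \<Rightarrow> nat \<Rightarrow> nat \<Rightarrow> nat set" where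
  "ins_nbrs E i v = {u. {v, u} \<in> E (Suc i) \<and> {v, u} \<notin> E i}"

definition del_nbrs :: "(nat \<Rightarrow> nat set set) \<Rightarrow> nat \<Rightarrow> nat \<Rightarrow> nat set" where
  "del_nbrs E i v = {u. {v, u} \<in> E i \<and> {v, u} \<notin> E (Suc i)}"

text \<open>run A n E i v = local state of v at the end of round i (i = 0: initial state).\<close>
fun run :: "dalg \<Rightarrow> nat \<Rightarrow> (nat \<Rightarrow> nat set set) \<Rightarrow> nat \<Rightarrow> nat \<Rightarrow> nat list" where
  "run A n E 0 v = init A n v"
| "run A n E (Suc i) v =
     recv A n v (run A n E i v) (ins_nbrs E i v) (del_nbrs E i v)
       {(u, send A n u (run A n E i u) (ins_nbrs E i u) (del_nbrs E i u) v) | u. {u, v} \<in> E (Suc i)}"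

text \<open>A query for k-cycle listing: a cyclically ordered set of k nodes, given as a
  list (up to rotation).\<close>
definition valid_query :: "nat \<Rightarrow> nat set \<Rightarrow> nat list \<Rightarrow> bool" where
  "valid_query k V H \<longleftrightarrow> length H = k \<and> distinct H \<and> set H \<subseteq> V"

definition is_rotation_of :: "nat list \<Rightarrow> nat list \<Rightarrow> bool" where
  "is_rotation_of q H \<longleftrightarrow> (\<exists>r. q = rotate r H)"

definition is_k_cycle :: "nat set set \<Rightarrow> nat list \<Rightarrow> bool" where
  "is_k_cycle F H \<longleftrightarrow> (\<forall>j < length H. {H ! j, H ! ((j + 1) mod length H)} \<in> F)"

definition node_inconsistent :: "dalg \<Rightarrow> nat \<Rightarrow> nat \<Rightarrow> nat set \<Rightarrow> (nat \<Rightarrow> nat set set) \<Rightarrow> nat \<Rightarrow> nat \<Rightarrow> bool" where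
  "node_inconsistent A k n V E i v \<longleftrightarrow>
     (\<exists>q. valid_query k V q \<and> v \<in> set q \<and> query A n v (run A n E i v) q = Inconsistent)"

definition num_changes :: "(nat \<Rightarrow> nat set set) \<Rightarrow> nat \<Rightarrow> nat" where
  "num_changes E i = (\<Sum>j\<in>{1..i}. card ((E (j - 1) - E j) \<union> (E j - E (j - 1))))"

definition num_inconsistent_rounds :: "dalg \<Rightarrow> nat \<Rightarrow> nat \<Rightarrow> nat set \<Rightarrow> (nat \<Rightarrow> nat set set) \<Rightarrow> nat \<Rightarrow> nat" where
  "num_inconsistent_rounds A k n V E i =
     card {j \<in> {1..i}. \<exists>v\<in>V. node_inconsistent A k n V E j v}"

definition listing_correct :: "dalg \<Rightarrow> nat \<Rightarrow> nat \<Rightarrow> nat set \<Rightarrow> (nat \<Rightarrow> nat set set) \<Rightarrow> nat \<Rightarrow> bool" where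
  "listing_correct A k n V E i \<longleftrightarrow>
     (\<forall>H qs. valid_query k V H \<longrightarrow> (\<forall>w\<in>set H. is_rotation_of (qs w) H) \<longrightarrow>
        (\<exists>w\<in>set H. query A n w (run A n E i w) (qs w) = Inconsistent) \<or>
        ((\<exists>w\<in>set H. query A n w (run A n E i w) (qs w) = Yes) \<longleftrightarrow> is_k_cycle (E (i - 1)) H))"

definition good_cycle_listing_ds :: "nat \<Rightarrow> nat \<Rightarrow> dalg \<Rightarrow> real \<Rightarrow> real \<Rightarrow> bool" where
  "good_cycle_listing_ds k d A c B \<longleftrightarrow>
     (\<forall>n V E. finite V \<longrightarrow> card V = n \<longrightarrow> V \<subseteq> {..< n ^ d} \<longrightarrow> valid_graph_seq V E \<longrightarrow>
        (\<forall>i u v. {u, v} \<in> E (Suc i) \<longrightarrow>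
            real (length (send A n u (run A n E i u) (ins_nbrs E i u) (del_nbrs E i u) v))
              \<le> B * log 2 (real n + 1)) \<and>
        (\<forall>i \<ge> 1. listing_correct A k n V E i) \<and>
        (\<forall>i. real (num_inconsistent_rounds A k n V E i) \<le> c * real (num_changes E i)))"

end

theory Submission
  imports Defs "HOL-Library.Countable"
begin

text \<open>Every node keeps a set of incident edges whose status it has not yet announced and, in every
  round, announces the status of one of them to all its neighbours; only if there is none does it
  relay one of the announcements it has received. A node is inconsistent while it has anything left to
  announce or relay. Consequently, when all nodes of a cycle are consistent, a node \<open>a\<close> with edges
  \<open>ab\<close>, \<open>bc\<close>, \<open>cd\<close> knows the path \<open>abcd\<close> whenever \<open>cd\<close> was inserted no earlier than \<open>ab\<close> and \<open>bc\<close>: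
  the insertion of \<open>cd\<close> was announced by \<open>c\<close> to \<open>b\<close> and relayed by \<open>b\<close> to \<open>a\<close>. If \<open>cd\<close> is the newest
  edge of a 4-cycle \<open>abcd\<close>, then \<open>a\<close> knows the cycle from this path and its own edge \<open>ad\<close>; if it is the
  newest edge of a 5-cycle \<open>abcde\<close>, then \<open>a\<close> knows it from the two paths \<open>abcd\<close> and \<open>aedc\<close>.\<close>

section \<open>States, messages and transitions of a node\<close>

text \<open>In the state of a node \<open>v\<close>: \<open>Dirty u\<close> is an unannounced status change of \<open>vu\<close>,
  \<open>Pending u w\<close> an announcement about \<open>uw\<close> received from \<open>u\<close> and not yet relayed,
  \<open>Heard u w\<close> says that \<open>uw\<close> is present according to \<open>u\<close>, and \<open>Path u w x\<close> that
  \<open>vuwx\<close> is a path according to \<open>u\<close>.\<close>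

datatype fact = Nbr nat | Dirty nat | Pending nat nat | Heard nat nat | Path nat nat nat

instance fact :: countable
  by countable_datatype

datatype msg = Silent | Own nat bool | Relay nat nat bool

text \<open>What is sent is the status held in the state, not the kind of change, so several changes
  of one edge collapse into one announcement. \<open>SOME\<close> makes the choice among waiting
  items arbitrary but deterministic.\<close>

definition outgoing :: "fact set \<Rightarrow> msg" where
  "outgoing \<sigma> =
     (if \<exists>u. Dirty u \<in> \<sigma> then let u = (SOME u. Dirty u \<in> \<sigma>) in Own u (Nbr u \<in> \<sigma>)
      else if \<exists>p. Pending (fst p) (snd p) \<in> \<sigma>
      then let p = (SOME p. Pending (fst p) (snd p) \<in> \<sigma>) in Relay (fst p) (snd p) (Heard (fst p) (snd p) \<in> \<sigma>)
      else Silent)"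

text \<open>Announcements about \<open>uw\<close>, even positive ones, erase all \<open>Path u w x\<close>, since \<open>uw\<close> may have been
  deleted and reinserted in between. No information is lost, because relays wait until
  there is nothing to announce.\<close>

definition step :: "fact set \<Rightarrow> nat set \<Rightarrow> nat set \<Rightarrow> (nat \<times> msg) set \<Rightarrow> fact set" where
  "step \<sigma> I D R =
     {Nbr u | u. u \<in> I \<or> Nbr u \<in> \<sigma> \<and> u \<notin> D} \<union>
     {Dirty u | u. u \<in> I \<union> D \<or> Dirty u \<in> \<sigma> \<and> (\<forall>s. outgoing \<sigma> \<noteq> Own u s)} \<union>
     {Pending u w | u w. (\<exists>s. (u, Own w s) \<in> R) \<or>
        Pending u w \<in> \<sigma> \<and> (\<forall>s. outgoing \<sigma> \<noteq> Relay u w s)} \<union>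
     {Heard u w | u w. (u, Own w True) \<in> R \<or>
        Heard u w \<in> \<sigma> \<and> u \<notin> I \<union> D \<and> (u, Own w False) \<notin> R} \<union>
     {Path u w x | u w x. (u, Relay w x True) \<in> R \<or>
        Path u w x \<in> \<sigma> \<and> u \<notin> I \<union> D \<and> (u, Relay w x False) \<notin> R \<and> (\<forall>s. (u, Own w s) \<notin> R)}"

lemma step_simps [simp]:
  "Nbr u \<in> step \<sigma> I D R \<longleftrightarrow> u \<in> I \<or> Nbr u \<in> \<sigma> \<and> u \<notin> D"
  "Dirty u \<in> step \<sigma> I D R \<longleftrightarrow> u \<in> I \<or> u \<in> D \<or> Dirty u \<in> \<sigma> \<and> (\<forall>s. outgoing \<sigma> \<noteq> Own u s)"
  "Pending u w \<in> step \<sigma> I D R \<longleftrightarrow> (\<exists>s. (u, Own w s) \<in> R) \<or>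
     Pending u w \<in> \<sigma> \<and> (\<forall>s. outgoing \<sigma> \<noteq> Relay u w s)"
  "Heard u w \<in> step \<sigma> I D R \<longleftrightarrow> (u, Own w True) \<in> R \<or>
     Heard u w \<in> \<sigma> \<and> u \<notin> I \<and> u \<notin> D \<and> (u, Own w False) \<notin> R"
  "Path u w x \<in> step \<sigma> I D R \<longleftrightarrow> (u, Relay w x True) \<in> R \<or>
     Path u w x \<in> \<sigma> \<and> u \<notin> I \<and> u \<notin> D \<and> (u, Relay w x False) \<notin> R \<and> (\<forall>s. (u, Own w s) \<notin> R)"
  unfolding step_def by blast+

lemma outgoing_OwnD:
  assumes "outgoing \<sigma> = Own u s"
  shows "Dirty u \<in> \<sigma>" "s \<longleftrightarrow> Nbr u \<in> \<sigma>"
proof -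
  have ex: "\<exists>u. Dirty u \<in> \<sigma>"
    using assms by (auto simp: outgoing_def Let_def split: if_splits)
  then have "u = (SOME u. Dirty u \<in> \<sigma>)" "s \<longleftrightarrow> Nbr u \<in> \<sigma>"
    using assms by (auto simp: outgoing_def Let_def)
  then show "Dirty u \<in> \<sigma>" "s \<longleftrightarrow> Nbr u \<in> \<sigma>"
    using someI_ex[OF ex] by auto
qed

lemma outgoing_RelayD:
  assumes "outgoing \<sigma> = Relay u w s"
  shows "Pending u w \<in> \<sigma>" "s \<longleftrightarrow> Heard u w \<in> \<sigma>" "Dirty x \<notin> \<sigma>"
proof -
  have nex: "\<not> (\<exists>u. Dirty u \<in> \<sigma>)" and ex: "\<exists>p. Pending (fst p) (snd p) \<in> \<sigma>"
    using assms by (auto simp: outgoing_def Let_def split: if_splits)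
  then have "(u, w) = (SOME p. Pending (fst p) (snd p) \<in> \<sigma>)" "s \<longleftrightarrow> Heard u w \<in> \<sigma>"
    using assms by (auto simp: outgoing_def Let_def split: if_splits)
  then show "Pending u w \<in> \<sigma>" "s \<longleftrightarrow> Heard u w \<in> \<sigma>" "Dirty x \<notin> \<sigma>"
    using someI_ex[OF ex] nex by (auto simp: prod_eq_iff)
qed

lemma outgoing_Dirty: "Dirty u \<in> \<sigma> \<Longrightarrow> \<exists>w s. outgoing \<sigma> = Own w s"
  by (auto simp: outgoing_def Let_def)

lemma outgoing_Pending:
  "Pending u w \<in> \<sigma> \<Longrightarrow> \<forall>x. Dirty x \<notin> \<sigma> \<Longrightarrow> \<exists>x y s. outgoing \<sigma> = Relay x y s"
  by (auto simp: outgoing_def Let_def)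

section \<open>Finite universes of facts and message length\<close>

definition facts_over :: "nat set \<Rightarrow> fact set" where
  "facts_over V = Nbr ` V \<union> Dirty ` V \<union> (\<lambda>(u, w). Pending u w) ` (V \<times> V) \<union>
     (\<lambda>(u, w). Heard u w) ` (V \<times> V) \<union> (\<lambda>(u, w, x). Path u w x) ` (V \<times> V \<times> V)"

lemma facts_over_simps [simp]:
  "Nbr u \<in> facts_over V \<longleftrightarrow> u \<in> V"
  "Dirty u \<in> facts_over V \<longleftrightarrow> u \<in> V"
  "Pending u w \<in> facts_over V \<longleftrightarrow> u \<in> V \<and> w \<in> V"
  "Heard u w \<in> facts_over V \<longleftrightarrow> u \<in> V \<and> w \<in> V"
  "Path u w x \<in> facts_over V \<longleftrightarrow> u \<in> V \<and> w \<in> V \<and> x \<in> V"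
  by (auto simp: facts_over_def image_iff)

lemma facts_over_mono: "V \<subseteq> W \<Longrightarrow> facts_over V \<subseteq> facts_over W"
  unfolding facts_over_def by (intro Un_mono image_mono Sigma_mono)

lemma finite_facts_over: "finite V \<Longrightarrow> finite (facts_over V)"
  by (simp add: facts_over_def)

definition msgs_over :: "nat set \<Rightarrow> msg set" where
  "msgs_over V = {Silent} \<union> (\<lambda>(u, s). Own u s) ` (V \<times> UNIV) \<union>
     (\<lambda>(u, w, s). Relay u w s) ` (V \<times> V \<times> UNIV)"

lemma msgs_over_simps [simp]:
  "Silent \<in> msgs_over V"
  "Own u s \<in> msgs_over V \<longleftrightarrow> u \<in> V"
  "Relay u w s \<in> msgs_over V \<longleftrightarrow> u \<in> V \<and> w \<in> V"
  by (auto simp: msgs_over_def image_iff)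

lemma outgoing_in_msgs_over:
  assumes "\<sigma> \<subseteq> facts_over V"
  shows "outgoing \<sigma> \<in> msgs_over V"
proof (cases "outgoing \<sigma>")
  case (Own u s)
  then show ?thesis
    using outgoing_OwnD(1)[OF Own] assms by auto
next
  case (Relay u w s)
  then show ?thesis
    using outgoing_RelayD(1)[OF Relay] assms by auto
qed simp

lemma step_in_facts_over:
  assumes "\<sigma> \<subseteq> facts_over V" "I \<subseteq> V" "D \<subseteq> V" "R \<subseteq> V \<times> msgs_over V"
  shows "step \<sigma> I D R \<subseteq> facts_over V"
proof
  fix f
  assume f: "f \<in> step \<sigma> I D R"
  have R: "(u, m) \<in> R \<Longrightarrow> u \<in> V \<and> m \<in> msgs_over V" for u m
    using assms(4) by auto
  show "f \<in> facts_over V"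
    using f assms(1-3) by (cases f) (auto dest!: R)
qed

lemma card_msgs_over_le:
  assumes "finite V"
  shows "card (msgs_over V) \<le> 1 + 2 * card V + 2 * (card V)\<^sup>2"
proof -
  have "card ((\<lambda>(u, s). Own u s) ` (V \<times> (UNIV :: bool set))) \<le> card (V \<times> (UNIV :: bool set))"
    by (rule card_image_le) (use assms in simp)
  moreover have "card ((\<lambda>(u, w, s). Relay u w s) ` (V \<times> V \<times> (UNIV :: bool set)))
      \<le> card (V \<times> V \<times> (UNIV :: bool set))"
    by (rule card_image_le) (use assms in simp)
  moreover have "card (msgs_over V) \<le> card {Silent}
      + card ((\<lambda>(u, s). Own u s) ` (V \<times> (UNIV :: bool set)))
      + card ((\<lambda>(u, w, s). Relay u w s) ` (V \<times> V \<times> (UNIV :: bool set)))"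
    unfolding msgs_over_def by (intro order_trans[OF card_Un_le] add_mono) simp_all
  ultimately show ?thesis
    by (simp add: card_cartesian_product power2_eq_square)
qed

text \<open>The number of messages is quadratic in the number \<open>n ^ d\<close> of identifiers,
  so bit strings of one common length \<open>L\<close> suffice.\<close>

lemma short_encoding_exists:
  fixes n d :: nat
  shows "\<exists>f :: msg \<Rightarrow> bool list. inj_on f (msgs_over {..<n ^ d}) \<and>
     (n \<ge> 1 \<longrightarrow> (\<forall>m \<in> msgs_over {..<n ^ d}.
        real (length (f m)) \<le> (3 + 4 * real d) * log 2 (real n + 1)))"
proof -
  define l where "l = nat \<lceil>log 2 (real n + 1)\<rceil>"
  \<comment> \<open>Chosen so that \<open>2 ^ L\<close> is 8 times the square of
    \<open>2 ^ (l * d)\<close>, which bounds \<open>n ^ d\<close>.\<close>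
  define L where "L = 3 + 2 * d * l"
  have "log 2 (real n + 1) \<le> real l"
    unfolding l_def by linarith
  then have "real n + 1 \<le> 2 powr real l"
    by (simp add: log_le_iff)
  then have "real n \<le> real (2 ^ l)"
    unfolding powr_realpow[of 2 l, simplified] of_nat_power of_nat_numeral by linarith
  then have "n \<le> 2 ^ l"
    by (simp only: of_nat_le_iff)
  then have N: "n ^ d \<le> 2 ^ (l * d)"
    by (metis power_mono power_mult zero_le)
  let ?M = "(2::nat) ^ (l * d)"
  have "card (msgs_over {..<n ^ d}) \<le> 1 + 2 * n ^ d + 2 * (n ^ d)\<^sup>2"
    using card_msgs_over_le[of "{..<n ^ d}"] by simp
  also have "\<dots> \<le> 1 + 2 * ?M + 2 * ?M\<^sup>2"
    using N by (intro add_mono mult_left_mono power_mono) auto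
  also have "\<dots> \<le> 8 * ?M\<^sup>2"
  proof -
    have "1 \<le> ?M" by simp
    then have "1 \<le> ?M\<^sup>2" "?M \<le> ?M\<^sup>2"
      by (simp_all add: power2_eq_square)
    then show ?thesis by linarith
  qed
  also have "\<dots> = 2 ^ L"
    by (simp add: L_def power_add power_mult[symmetric] mult.commute mult.left_commute)
  finally have "card (msgs_over {..<n ^ d}) \<le> card {bs :: bool list. length bs = L}"
    using card_lists_length_eq[of "UNIV :: bool set" L] by simp
  moreover have "finite (msgs_over {..<n ^ d})" "finite {bs :: bool list. length bs = L}"
    using finite_lists_length_eq[of "UNIV :: bool set" L] by (simp_all add: msgs_over_def)
  ultimately obtain f :: "msg \<Rightarrow> bool list"
    where f: "f ` msgs_over {..<n ^ d} \<subseteq> {bs. length bs = L}" "inj_on f (msgs_over {..<n ^ d})"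
    by (meson card_le_inj)
  have "real L \<le> (3 + 4 * real d) * log 2 (real n + 1)" if "n \<ge> 1"
  proof -
    \<comment> \<open>A logarithm of at least 1 absorbs both the rounding in \<open>l\<close> and
      the constant 3.\<close>
    have 1: "1 \<le> log 2 (real n + 1)"
      using that by (simp add: le_log_iff)
    then have "real l \<le> 2 * log 2 (real n + 1)"
      unfolding l_def by linarith
    then have "2 * real d * real l \<le> 2 * real d * (2 * log 2 (real n + 1))"
      by (intro mult_left_mono) auto
    then show ?thesis
      using 1 unfolding L_def of_nat_add of_nat_mult of_nat_numeral distrib_right by linarith
  qed
  then show ?thesis
    using f by (intro exI[of _ f]) (auto simp: image_subset_iff)
qed

section \<open>The algorithm and its unencoded run\<close>

definition encode_facts :: "fact set \<Rightarrow> nat list" where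
  "encode_facts \<sigma> = sorted_list_of_set (to_nat ` \<sigma>)"

definition decode_facts :: "nat list \<Rightarrow> fact set" where
  "decode_facts xs = {f. to_nat f \<in> set xs}"

text \<open>Facts are countable, so finite states fit the \<open>nat list\<close> of the model; an
  infinite set would be encoded as the empty list.\<close>

lemma decode_encode_facts: "finite \<sigma> \<Longrightarrow> decode_facts (encode_facts \<sigma>) = \<sigma>"
  by (auto simp: decode_facts_def encode_facts_def inj_image_mem_iff)

text \<open>Queries are fixed only up to rotation, so \<open>v\<close> is first brought to the
  front. The edge \<open>rs\<close> is the candidate for the newest one; on a 5-cycle it is reached
  from both sides.\<close>

definition detects :: "nat \<Rightarrow> fact set \<Rightarrow> nat list \<Rightarrow> bool" where
  "detects v \<sigma> q \<longleftrightarrow>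
     (\<exists>m p r s. rotate m q = [v, p, r, s] \<and> Nbr p \<in> \<sigma> \<and> Nbr s \<in> \<sigma> \<and> Path p r s \<in> \<sigma>) \<or>
     (\<exists>m p r s u. rotate m q = [v, p, r, s, u] \<and> Nbr p \<in> \<sigma> \<and> Nbr u \<in> \<sigma> \<and>
        Path p r s \<in> \<sigma> \<and> Path u s r \<in> \<sigma>)"

definition quiet :: "fact set \<Rightarrow> bool" where
  "quiet \<sigma> \<longleftrightarrow> (\<forall>u. Dirty u \<notin> \<sigma>) \<and> (\<forall>u w. Pending u w \<notin> \<sigma>)"

definition answer_query :: "nat \<Rightarrow> fact set \<Rightarrow> nat list \<Rightarrow> answer" where
  "answer_query v \<sigma> q = (if \<not> quiet \<sigma> then Inconsistent else if detects v \<sigma> q then Yes else No)"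

text \<open>A node knows \<open>n\<close> but not \<open>V\<close>, so bit strings are decoded over
  all identifiers below \<open>n ^ d\<close>.\<close>

definition cycle_alg :: "nat \<Rightarrow> (nat \<Rightarrow> msg \<Rightarrow> bool list) \<Rightarrow> dalg" where
  "cycle_alg d enc = \<lparr>
     init = (\<lambda>n v. encode_facts {}),
     send = (\<lambda>n v xs I D w. enc n (outgoing (decode_facts xs))),
     recv = (\<lambda>n v xs I D R. encode_facts (step (decode_facts xs) I D
        ((\<lambda>(u, bs). (u, inv_into (msgs_over {..<n ^ d}) (enc n) bs)) ` R))),
     query = (\<lambda>n v xs q. answer_query v (decode_facts xs) q)\<rparr>"

fun facts_at :: "(nat \<Rightarrow> nat set set) \<Rightarrow> nat \<Rightarrow> nat \<Rightarrow> fact set" where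
  "facts_at E 0 v = {}"
| "facts_at E (Suc i) v = step (facts_at E i v) (ins_nbrs E i v) (del_nbrs E i v)
     {(u, outgoing (facts_at E i u)) | u. {u, v} \<in> E (Suc i)}"

section \<open>Insertion times and rotations of cycles\<close>

text \<open>The round of the last insertion; a deletion leaves it unchanged, and 0 stands for no
  insertion so far.\<close>

fun ins_time :: "(nat \<Rightarrow> nat set set) \<Rightarrow> nat \<Rightarrow> nat set \<Rightarrow> nat" where
  "ins_time E 0 e = 0"
| "ins_time E (Suc i) e = (if e \<in> E (Suc i) - E i then Suc i else ins_time E i e)"

lemma ins_time_le: "ins_time E i e \<le> i"
  by (induction i) auto

text \<open>Rotating by \<open>length H\<close> is the identity, so
  \<open>r * (length H - 1)\<close> further rotations undo \<open>r\<close> of them.\<close>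

lemma rotation_extend:
  assumes "is_rotation_of q H"
  shows "\<exists>l. rotate l q = rotate m H"
proof -
  obtain r where r: "q = rotate r H"
    using assms by (auto simp: is_rotation_of_def)
  show ?thesis
  proof (cases "H = []")
    case True
    then show ?thesis using r by simp
  next
    case False
    then have "m + r * (length H - 1) + r = m + r * length H"
      by (cases "length H") auto
    then have "rotate (m + r * (length H - 1)) q = rotate m H"
      unfolding r rotate_rotate by (metis mod_mult_self1 rotate_conv_mod)
    then show ?thesis by blast
  qed
qed

lemma is_k_cycle_rotate: "is_k_cycle F (rotate m H) \<longleftrightarrow> is_k_cycle F H"
proof -
  have rot: "is_k_cycle F (rotate l G)" if "is_k_cycle F G" for l G
    unfolding is_k_cycle_def
  proof (intro allI impI)
    fix j
    assume j: "j < length (rotate l G)"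
    then have pos: "length G > 0" and lt: "(j + 1) mod length G < length G"
      by (auto intro: mod_less_divisor)
    have "{G ! ((l + j) mod length G), G ! (((l + j) mod length G + 1) mod length G)} \<in> F"
      using that pos by (simp add: is_k_cycle_def)
    moreover have "rotate l G ! j = G ! ((l + j) mod length G)"
      using j by (simp add: nth_rotate)
    moreover have "rotate l G ! ((j + 1) mod length G) = G ! (((l + j) mod length G + 1) mod length G)"
      using lt by (simp add: nth_rotate mod_simps)
    ultimately show "{rotate l G ! j, rotate l G ! ((j + 1) mod length (rotate l G))} \<in> F"
      by simp
  qed
  obtain l where "rotate l (rotate m H) = rotate 0 H"
    using rotation_extend[of "rotate m H" H 0] by (auto simp: is_rotation_of_def)
  then show ?thesis
    using rot[of H m] rot[of "rotate m H" l] by auto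
qed

lemma is_k_cycle_4:
  "is_k_cycle F [a, b, c, d] \<longleftrightarrow> {a, b} \<in> F \<and> {b, c} \<in> F \<and> {c, d} \<in> F \<and> {d, a} \<in> F"
  by (auto simp: is_k_cycle_def All_less_Suc)

lemma is_k_cycle_5:
  "is_k_cycle F [a, b, c, d, e] \<longleftrightarrow>
    {a, b} \<in> F \<and> {b, c} \<in> F \<and> {c, d} \<in> F \<and> {d, e} \<in> F \<and> {e, a} \<in> F"
  by (auto simp: is_k_cycle_def All_less_Suc)

text \<open>With \<open>w\<close> the insertion time, this makes the newest edge the third one of
  the cycle, as seen from the node that will detect it.\<close>

lemma rotate_max_edge_to_2:
  fixes w :: "nat set \<Rightarrow> nat"
  assumes "length H \<in> {4, 5}"
  shows "\<exists>m. \<forall>j<length H. w {rotate m H ! j, rotate m H ! ((j + 1) mod length H)}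
      \<le> w {rotate m H ! 2, rotate m H ! 3}"
proof -
  let ?k = "length H"
  let ?f = "\<lambda>j. w {H ! j, H ! ((j + 1) mod ?k)}"
  have k: "?k > 3" using assms by auto
  have "finite (?f ` {..<?k})" "?f ` {..<?k} \<noteq> {}"
    using k by (auto simp: lessThan_empty_iff)
  then obtain j0 where j0: "j0 < ?k" and max: "\<And>j. j < ?k \<Longrightarrow> ?f j \<le> ?f j0"
    using Max_in[of "?f ` {..<?k}"] Max_ge[of "?f ` {..<?k}"] by (smt (verit) imageE imageI lessThan_iff)
  \<comment> \<open>This is \<open>j0 - 2\<close> modulo the length, written without truncated
    subtraction.\<close>
  define m where "m = j0 + (?k - 2)"
  have "m + 2 = j0 + ?k" "m + 3 = (j0 + 1) + ?k"
    using k by (auto simp: m_def)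
  then have "(m + 2) mod ?k = j0" "(m + 3) mod ?k = (j0 + 1) mod ?k"
    using j0 by (simp_all only: mod_add_self2 mod_less)
  then have two: "rotate m H ! 2 = H ! j0" "rotate m H ! 3 = H ! ((j0 + 1) mod ?k)"
    using k by (auto simp: nth_rotate)
  show ?thesis
  proof (intro exI allI impI)
    fix j
    assume j: "j < ?k"
    have lt: "(j + 1) mod ?k < ?k" using j by (intro mod_less_divisor) auto
    have "rotate m H ! j = H ! ((m + j) mod ?k)"
      using j by (simp add: nth_rotate)
    moreover have "rotate m H ! ((j + 1) mod ?k) = H ! (((m + j) mod ?k + 1) mod ?k)"
      using lt by (simp add: nth_rotate mod_simps)
    moreover have "(m + j) mod ?k < ?k" using j by (intro mod_less_divisor) auto
    ultimately show "w {rotate m H ! j, rotate m H ! ((j + 1) mod ?k)} \<le> w {rotate m H ! 2, rotate m H ! 3}"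
      using max two by simp
  qed
qed

section \<open>Runs on a fixed network and their recurrences\<close>

locale dynamic_network =
  fixes V :: "nat set" and E :: "nat \<Rightarrow> nat set set"
  assumes finite_V: "finite V" and valid: "valid_graph_seq V E"
begin

lemma E_0: "E 0 = {}"
  using valid by (simp add: valid_graph_seq_def)

lemma edge_in_V:
  assumes "{u, w} \<in> E i"
  shows "u \<in> V" "w \<in> V"
proof -
  obtain a b where "a \<in> V" "b \<in> V" "{u, w} = {a, b}"
    using valid assms unfolding valid_graph_seq_def by metis
  then show "u \<in> V" "w \<in> V"
    by (auto simp: doubleton_eq_iff)
qed

text \<open>This keeps states finite, hence encodable, and confines messages to the range on which
  the encoding is injective and short.\<close>

lemma facts_at_in_facts_over: "facts_at E i v \<subseteq> facts_over V"
proof (induction i arbitrary: v)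
  case (Suc i)
  have "{(u, outgoing (facts_at E i u)) | u. {u, v} \<in> E (Suc i)} \<subseteq> V \<times> msgs_over V"
    using edge_in_V outgoing_in_msgs_over[OF Suc] by blast
  moreover have "ins_nbrs E i v \<subseteq> V" "del_nbrs E i v \<subseteq> V"
    using edge_in_V by (auto simp: ins_nbrs_def del_nbrs_def)
  ultimately show ?case
    using step_in_facts_over[OF Suc] by simp
qed simp

lemma finite_facts_at: "finite (facts_at E i v)"
  using finite_subset[OF facts_at_in_facts_over finite_facts_over[OF finite_V]] .

lemma run_cycle_alg:
  assumes inj: "inj_on (enc n) (msgs_over {..<n ^ d})" and V: "V \<subseteq> {..<n ^ d}"
  shows "run (cycle_alg d enc) n E i v = encode_facts (facts_at E i v)"
proof (induction i arbitrary: v)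
  case 0
  then show ?case by (simp add: cycle_alg_def)
next
  case (Suc i)
  have "facts_at E i u \<subseteq> facts_over {..<n ^ d}" for u
    by (rule order_trans[OF facts_at_in_facts_over facts_over_mono[OF V]])
  then have "inv_into (msgs_over {..<n ^ d}) (enc n) (enc n (outgoing (facts_at E i u)))
      = outgoing (facts_at E i u)" for u
    by (intro inv_into_f_f[OF inj] outgoing_in_msgs_over)
  then have R: "(\<lambda>(u, bs). (u, inv_into (msgs_over {..<n ^ d}) (enc n) bs)) `
      {(u, enc n (outgoing (facts_at E i u))) | u. {u, v} \<in> E (Suc i)}
      = {(u, outgoing (facts_at E i u)) | u. {u, v} \<in> E (Suc i)}"
    by (force simp: image_iff)
  show ?case
    using Suc R by (simp add: cycle_alg_def decode_encode_facts[OF finite_facts_at])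
qed

lemma Nbr_iff: "Nbr u \<in> facts_at E i v \<longleftrightarrow> {v, u} \<in> E i"
  by (induction i) (auto simp: E_0 ins_nbrs_def del_nbrs_def)

lemma Dirty_Suc: "Dirty u \<in> facts_at E (Suc i) v \<longleftrightarrow>
    ({v, u} \<in> E i) \<noteq> ({v, u} \<in> E (Suc i)) \<or>
    Dirty u \<in> facts_at E i v \<and> (\<forall>s. outgoing (facts_at E i v) \<noteq> Own u s)"
  by (auto simp: ins_nbrs_def del_nbrs_def)

lemma Pending_Suc: "Pending u w \<in> facts_at E (Suc i) v \<longleftrightarrow>
    (\<exists>s. outgoing (facts_at E i u) = Own w s) \<and> {u, v} \<in> E (Suc i) \<or>
    Pending u w \<in> facts_at E i v \<and> (\<forall>s. outgoing (facts_at E i v) \<noteq> Relay u w s)"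
  by (auto simp: eq_commute[of "Own w _"])

lemma Heard_Suc: "Heard u w \<in> facts_at E (Suc i) v \<longleftrightarrow>
    outgoing (facts_at E i u) = Own w True \<and> {u, v} \<in> E (Suc i) \<or>
    Heard u w \<in> facts_at E i v \<and> ({v, u} \<in> E i) = ({v, u} \<in> E (Suc i)) \<and>
    \<not> (outgoing (facts_at E i u) = Own w False \<and> {u, v} \<in> E (Suc i))"
  by (auto simp: ins_nbrs_def del_nbrs_def)

lemma Path_Suc: "Path u w x \<in> facts_at E (Suc i) v \<longleftrightarrow>
    outgoing (facts_at E i u) = Relay w x True \<and> {u, v} \<in> E (Suc i) \<or>
    Path u w x \<in> facts_at E i v \<and> ({v, u} \<in> E i) = ({v, u} \<in> E (Suc i)) \<and>
    \<not> (outgoing (facts_at E i u) = Relay w x False \<and> {u, v} \<in> E (Suc i)) \<and>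
    \<not> ((\<exists>s. outgoing (facts_at E i u) = Own w s) \<and> {u, v} \<in> E (Suc i))"
  by (auto simp: ins_nbrs_def del_nbrs_def eq_commute[of "Own w _"])

text \<open>From here on the recurrences above replace the unfolding of \<open>step\<close>.\<close>

declare facts_at.simps(2) [simp del]

section \<open>Soundness of heard edges and paths\<close>

lemma Heard_nbr: "Heard b c \<in> facts_at E i a \<Longrightarrow> {a, b} \<in> E i"
  by (induction i) (auto simp: Heard_Suc insert_commute)

text \<open>Any change of \<open>bc\<close> leaves \<open>c\<close> dirty at \<open>b\<close> until
  \<open>b\<close> announces the status of \<open>bc\<close>, and a negative announcement erases the
  entry at \<open>a\<close>.\<close>

lemma Heard_sound:
  assumes "{a, b} \<in> E i" "Dirty c \<notin> facts_at E i b" "Heard b c \<in> facts_at E i a"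
  shows "{b, c} \<in> E i"
  using assms
proof (induction i)
  case (Suc i)
  have bc: "{b, c} \<in> E (Suc i) \<longleftrightarrow> {b, c} \<in> E i"
    using Suc.prems(2) by (auto simp: Dirty_Suc)
  show ?case
  proof (cases "\<exists>s. outgoing (facts_at E i b) = Own c s")
    case True
    then obtain s where s: "outgoing (facts_at E i b) = Own c s" by blast
    then have "s"
      using Suc.prems by (cases s) (auto simp: Heard_Suc insert_commute)
    then show ?thesis
      using outgoing_OwnD(2)[OF s] bc by (simp add: Nbr_iff)
  next
    case False
    then show ?thesis
      using Suc bc by (auto simp: Dirty_Suc Heard_Suc)
  qed
qed (simp add: E_0)

text \<open>\<open>Heard c d\<close> at \<open>b\<close> is affected only by a change of
  \<open>bc\<close>, which makes \<open>c\<close> dirty, or by an announcement, which makes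
  \<open>cd\<close> pending. Clearing the first mark erases the path at \<open>a\<close>; clearing
  the second updates it.\<close>

lemma Path_sound_Heard:
  assumes "{a, b} \<in> E i" "Dirty c \<notin> facts_at E i b" "Pending c d \<notin> facts_at E i b"
    "Path b c d \<in> facts_at E i a"
  shows "Heard c d \<in> facts_at E i b"
  using assms
proof (induction i)
  case (Suc i)
  have ba: "{b, a} \<in> E (Suc i)"
    using Suc.prems(1) by (simp add: insert_commute)
  have bc: "{b, c} \<in> E (Suc i) \<longleftrightarrow> {b, c} \<in> E i"
    using Suc.prems(2) by (auto simp: Dirty_Suc)
  have no_own: "outgoing (facts_at E i c) \<noteq> Own d s \<or> {c, b} \<notin> E (Suc i)" for s
    using Suc.prems(3) by (auto simp: Pending_Suc)
  have "Heard c d \<in> facts_at E i b"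
  proof (cases "\<exists>s. outgoing (facts_at E i b) = Relay c d s")
    case True
    then obtain s where s: "outgoing (facts_at E i b) = Relay c d s" by blast
    then have "s"
      using Suc.prems(4) ba by (cases s) (auto simp: Path_Suc)
    then show ?thesis
      using outgoing_RelayD(2)[OF s] by simp
  next
    case False
    then have "Path b c d \<in> facts_at E i a" "{a, b} \<in> E i" "\<forall>s. outgoing (facts_at E i b) \<noteq> Own c s"
      using Suc.prems(1,4) ba by (auto simp: Path_Suc)
    then show ?thesis
      using Suc.IH Suc.prems(2,3) False by (auto simp: Dirty_Suc Pending_Suc)
  qed
  then show ?case
    using bc no_own by (auto simp: Heard_Suc)
qed (simp add: E_0)

lemma Path_sound:
  assumes "{a, b} \<in> E i" "quiet (facts_at E i b)" "quiet (facts_at E i c)"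
    "Path b c d \<in> facts_at E i a"
  shows "{b, c} \<in> E i" "{c, d} \<in> E i"
proof -
  have "Heard c d \<in> facts_at E i b"
    using Path_sound_Heard assms by (auto simp: quiet_def)
  then show "{b, c} \<in> E i"
    by (rule Heard_nbr)
  then show "{c, d} \<in> E i"
    using Heard_sound \<open>Heard c d \<in> facts_at E i b\<close> assms(3) by (auto simp: quiet_def)
qed

section \<open>Completeness of heard edges and paths\<close>

text \<open>Being present in \<open>E i\<close>, \<open>f\<close> has insertion time at most
  \<open>i\<close>; so \<open>e\<close>, which is no newer, was not inserted in round
  \<open>Suc i\<close>. This lets the inductions below step back one round.\<close>

lemma ins_time_older:
  assumes "e \<in> E (Suc i)" "ins_time E (Suc i) e \<le> ins_time E (Suc i) f" "f \<in> E i"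
  shows "e \<in> E i" "ins_time E i e \<le> ins_time E i f"
  using assms ins_time_le[of E i f] by (auto split: if_splits)

text \<open>The insertion of \<open>bc\<close> is announced in a later round, and \<open>ab\<close>
  has been present at least since that insertion, so the announcement reaches \<open>a\<close> and
  is not erased.\<close>

lemma Heard_complete:
  assumes "{a, b} \<in> E i" "{b, c} \<in> E i" "ins_time E i {a, b} \<le> ins_time E i {b, c}"
    "Dirty c \<notin> facts_at E i b"
  shows "Heard b c \<in> facts_at E i a"
  using assms
proof (induction i)
  case (Suc i)
  have ba: "{b, a} \<in> E (Suc i)"
    using Suc.prems(1) by (simp add: insert_commute)
  have bc: "{b, c} \<in> E i"
    using Suc.prems(2,4) by (auto simp: Dirty_Suc)
  note ab = ins_time_older[OF Suc.prems(1,3) bc]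
  show ?case
  proof (cases "\<exists>s. outgoing (facts_at E i b) = Own c s")
    case True
    then obtain s where s: "outgoing (facts_at E i b) = Own c s" by blast
    then have "s"
      using outgoing_OwnD(2)[OF s] bc by (simp add: Nbr_iff)
    then show ?thesis
      using s ba by (simp add: Heard_Suc)
  next
    case False
    then have "Heard b c \<in> facts_at E i a"
      using Suc.IH Suc.prems(4) ab bc by (auto simp: Dirty_Suc)
    then show ?thesis
      using False ab Suc.prems(1) by (simp add: Heard_Suc)
  qed
qed (simp add: E_0)

text \<open>The clause on \<open>Dirty c\<close> carries the induction: a relay is sent only when
  \<open>b\<close> has nothing to announce, and \<open>bc\<close> does not change afterwards, so no
  announcement about \<open>bc\<close> erases the path again.\<close>

lemma Path_complete:
  assumes "{b, c} \<in> E i" "{c, d} \<in> E i" "ins_time E i {b, c} \<le> ins_time E i {c, d}"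
    "Dirty d \<notin> facts_at E i c" "Pending c d \<notin> facts_at E i b"
  shows "Dirty c \<notin> facts_at E i b \<and>
    (\<forall>a. {a, b} \<in> E i \<longrightarrow> ins_time E i {a, b} \<le> ins_time E i {c, d} \<longrightarrow>
       Path b c d \<in> facts_at E i a)"
  using assms
proof (induction i)
  case (Suc i)
  have cb: "{c, b} \<in> E (Suc i)"
    using Suc.prems(1) by (simp add: insert_commute)
  have cd: "{c, d} \<in> E i"
    using Suc.prems(2,4) by (auto simp: Dirty_Suc)
  note bc = ins_time_older[OF Suc.prems(1,3) cd]
  \<comment> \<open>Had \<open>c\<close> announced \<open>cd\<close> in this round, it would now be
    pending at \<open>b\<close>.\<close>
  have dirty: "Dirty d \<notin> facts_at E i c"
    using Suc.prems(4,5) cb by (auto simp: Dirty_Suc Pending_Suc)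
  have heard: "Heard c d \<in> facts_at E i b"
    by (rule Heard_complete[OF bc(1) cd bc(2) dirty])
  show ?case
  proof (cases "Pending c d \<in> facts_at E i b")
    case True
    \<comment> \<open>Pending before but not after the round: the relay takes place now.\<close>
    then obtain s where s: "outgoing (facts_at E i b) = Relay c d s"
      using Suc.prems(5) by (auto simp: Pending_Suc)
    then have "s" "Dirty c \<notin> facts_at E i b"
      using outgoing_RelayD[OF s] heard by auto
    then show ?thesis
      using s bc(1) Suc.prems(1) by (auto simp: Dirty_Suc Path_Suc insert_commute)
  next
    case False
    note IH = Suc.IH[OF bc(1) cd bc(2) dirty False]
    have no_own: "outgoing (facts_at E i b) \<noteq> Own c s" for s
      using IH outgoing_OwnD(1) by blast
    have no_relay: "outgoing (facts_at E i b) \<noteq> Relay c d s" for s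
      using False outgoing_RelayD(1) by blast
    show ?thesis
    proof (intro conjI allI impI)
      show "Dirty c \<notin> facts_at E (Suc i) b"
        using IH bc(1) Suc.prems(1) by (simp add: Dirty_Suc)
      fix a
      assume ab: "{a, b} \<in> E (Suc i)" "ins_time E (Suc i) {a, b} \<le> ins_time E (Suc i) {c, d}"
      note ab' = ins_time_older[OF ab cd]
      show "Path b c d \<in> facts_at E (Suc i) a"
        using IH ab ab' no_own no_relay by (simp add: Path_Suc del: ins_time.simps)
    qed
  qed
qed (simp add: E_0)

lemma Path_complete_quiet:
  assumes "{a, b} \<in> E i" "{b, c} \<in> E i" "{c, d} \<in> E i"
    "ins_time E i {a, b} \<le> ins_time E i {c, d}" "ins_time E i {b, c} \<le> ins_time E i {c, d}"
    "quiet (facts_at E i b)" "quiet (facts_at E i c)"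
  shows "Path b c d \<in> facts_at E i a"
  using Path_complete[of b c i d] assms by (auto simp: quiet_def)

section \<open>Correctness of the answers\<close>

text \<open>Messages depend only on the state at the end of the previous round, so an incident change always
  leaves a \<open>Dirty\<close> fact behind at the end of its round. Hence a cycle of quiet nodes looks the same
  in the last two graphs.\<close>

lemma quiet_unchanged:
  assumes "quiet (facts_at E (Suc i) v)"
  shows "{v, u} \<in> E (Suc i) \<longleftrightarrow> {v, u} \<in> E i"
  using assms by (auto simp: quiet_def Dirty_Suc)

lemma is_k_cycle_unchanged:
  assumes "\<forall>v \<in> set H. quiet (facts_at E (Suc i) v)"
  shows "is_k_cycle (E (Suc i)) H \<longleftrightarrow> is_k_cycle (E i) H"
  using assms quiet_unchanged by (auto simp: is_k_cycle_def)

lemma detects_sound: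
  assumes "detects v (facts_at E i v) q" "\<forall>v \<in> set q. quiet (facts_at E i v)"
  shows "is_k_cycle (E i) q"
proof -
  have rot: "is_k_cycle (E i) q" if "is_k_cycle (E i) (rotate m q)" for m
    using that is_k_cycle_rotate by blast
  from assms(1) consider
    (four) m p r s where "rotate m q = [v, p, r, s]" "Nbr p \<in> facts_at E i v"
      "Nbr s \<in> facts_at E i v" "Path p r s \<in> facts_at E i v"
  | (five) m p r s u where "rotate m q = [v, p, r, s, u]" "Nbr p \<in> facts_at E i v"
      "Nbr u \<in> facts_at E i v" "Path p r s \<in> facts_at E i v" "Path u s r \<in> facts_at E i v"
    unfolding detects_def by blast
  then show ?thesis
  proof cases
    case four
    have "quiet (facts_at E i p)" "quiet (facts_at E i r)"
      using assms(2) arg_cong[OF four(1), of set] by auto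
    then have "is_k_cycle (E i) [v, p, r, s]"
      using four Path_sound[of v p i r s]
      by (auto simp: is_k_cycle_4 Nbr_iff insert_commute)
    then show ?thesis
      using rot[of m] four(1) by simp
  next
    case five
    have "quiet (facts_at E i p)" "quiet (facts_at E i r)" "quiet (facts_at E i u)" "quiet (facts_at E i s)"
      using assms(2) arg_cong[OF five(1), of set] by auto
    then have "is_k_cycle (E i) [v, p, r, s, u]"
      using five Path_sound[of v p i r s] Path_sound[of v u i s r]
      by (auto simp: is_k_cycle_5 Nbr_iff insert_commute)
    then show ?thesis
      using rot[of m] five(1) by simp
  qed
qed

lemma detects_complete:
  assumes "is_k_cycle (E i) H" "length H \<in> {4, 5}"
    "\<forall>v \<in> set H. quiet (facts_at E i v)"
    "\<forall>w \<in> set H. is_rotation_of (qs w) H"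
  shows "\<exists>v \<in> set H. detects v (facts_at E i v) (qs v)"
proof -
  obtain m where m: "\<forall>j<length H. ins_time E i {rotate m H ! j, rotate m H ! ((j + 1) mod length H)}
      \<le> ins_time E i {rotate m H ! 2, rotate m H ! 3}"
    using rotate_max_edge_to_2[of H "ins_time E i"] assms(2) by auto
  have cyc: "is_k_cycle (E i) (rotate m H)"
    using assms(1) is_k_cycle_rotate by blast
  have requery: "\<exists>l. rotate l (qs v) = rotate m H" if "v \<in> set H" for v
    using rotation_extend assms(4) that by blast
  show ?thesis
  proof (cases "length H = 4")
    case True
    then have "length (rotate m H) = Suc (Suc (Suc (Suc 0)))" by simp
    then obtain v p r s where eq: "rotate m H = [v, p, r, s]"
      by (auto simp only: length_Suc_conv length_0_conv)
    have set: "set H = {v, p, r, s}"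
      using set_rotate[of m H] unfolding eq by simp
    have edges: "{v, p} \<in> E i" "{p, r} \<in> E i" "{r, s} \<in> E i" "{s, v} \<in> E i"
      using cyc unfolding eq is_k_cycle_4 by auto
    have "ins_time E i {v, p} \<le> ins_time E i {r, s}" "ins_time E i {p, r} \<le> ins_time E i {r, s}"
      using m[rule_format, of 0] m[rule_format, of 1] True unfolding eq by simp_all
    then have "Path p r s \<in> facts_at E i v"
      using edges assms(3) set by (intro Path_complete_quiet) auto
    then have "detects v (facts_at E i v) (qs v)"
      using requery[of v] edges unfolding detects_def eq
      by (auto simp: set Nbr_iff insert_commute)
    then show ?thesis
      using set by auto
  next
    case False
    then have len: "length H = 5" using assms(2) by simp
    then have "length (rotate m H) = Suc (Suc (Suc (Suc (Suc 0))))" by simp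
    then obtain v p r s u where eq: "rotate m H = [v, p, r, s, u]"
      by (auto simp only: length_Suc_conv length_0_conv)
    have set: "set H = {v, p, r, s, u}"
      using set_rotate[of m H] unfolding eq by simp
    have edges: "{v, p} \<in> E i" "{p, r} \<in> E i" "{r, s} \<in> E i" "{s, u} \<in> E i" "{u, v} \<in> E i"
      using cyc unfolding eq is_k_cycle_5 by auto
    have times: "ins_time E i {v, p} \<le> ins_time E i {r, s}" "ins_time E i {p, r} \<le> ins_time E i {r, s}"
      "ins_time E i {s, u} \<le> ins_time E i {r, s}" "ins_time E i {u, v} \<le> ins_time E i {r, s}"
      using m[rule_format, of 0] m[rule_format, of 1] m[rule_format, of 3] m[rule_format, of 4] len
      unfolding eq by simp_all
    have "Path p r s \<in> facts_at E i v"
      using edges times assms(3) set by (intro Path_complete_quiet) auto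
    \<comment> \<open>Both ends of the newest edge announce it, so it also arrives through
      \<open>s\<close> and \<open>u\<close>.\<close>
    moreover have "Path u s r \<in> facts_at E i v"
      using edges times assms(3) set by (intro Path_complete_quiet) (auto simp: insert_commute)
    ultimately have "detects v (facts_at E i v) (qs v)"
      using requery[of v] edges unfolding detects_def eq
      by (auto simp: set Nbr_iff insert_commute)
    then show ?thesis
      using set by auto
  qed
qed

lemma listing_correct_cycle_alg:
  assumes inj: "inj_on (enc n) (msgs_over {..<n ^ d})" and V: "V \<subseteq> {..<n ^ d}"
    and k: "k \<in> {4, 5}" and i: "i \<ge> 1"
  shows "listing_correct (cycle_alg d enc) k n V E i"
  unfolding listing_correct_def
proof (intro allI impI)
  fix H qs
  assume H: "valid_query k V H" and qs: "\<forall>w \<in> set H. is_rotation_of (qs w) H"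
  obtain j where j: "i = Suc j" using i by (cases i) auto
  have query: "query (cycle_alg d enc) n w (run (cycle_alg d enc) n E i w) q
      = answer_query w (facts_at E i w) q" for w q
    unfolding run_cycle_alg[where enc = enc and n = n and d = d, OF inj V]
    by (simp add: cycle_alg_def decode_encode_facts[OF finite_facts_at])
  show "(\<exists>w \<in> set H. query (cycle_alg d enc) n w (run (cycle_alg d enc) n E i w) (qs w) = Inconsistent) \<or>
     (\<exists>w \<in> set H. query (cycle_alg d enc) n w (run (cycle_alg d enc) n E i w) (qs w) = Yes)
       = is_k_cycle (E (i - 1)) H"
  proof (cases "\<forall>w \<in> set H. quiet (facts_at E i w)")
    case False
    then show ?thesis by (auto simp: query answer_query_def)
  next
    case True
    \<comment> \<open>The specification speaks of the previous graph, the states of the current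
      one.\<close>
    have "is_k_cycle (E (i - 1)) H \<longleftrightarrow> is_k_cycle (E i) H"
      using is_k_cycle_unchanged True j by simp
    also have "\<dots> \<longleftrightarrow> (\<exists>w \<in> set H. detects w (facts_at E i w) (qs w))"
    proof
      assume "is_k_cycle (E i) H"
      then show "\<exists>w \<in> set H. detects w (facts_at E i w) (qs w)"
        using detects_complete True qs H k by (auto simp: valid_query_def)
    next
      assume "\<exists>w \<in> set H. detects w (facts_at E i w) (qs w)"
      then obtain w where w: "w \<in> set H" "detects w (facts_at E i w) (qs w)" by blast
      obtain r where r: "qs w = rotate r H"
        using qs w(1) by (auto simp: is_rotation_of_def)
      have "is_k_cycle (E i) (qs w)"
        by (rule detects_sound[OF w(2)]) (use True r in simp)
      then show "is_k_cycle (E i) H"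
        using r is_k_cycle_rotate by simp
    qed
    also have "\<dots> \<longleftrightarrow> (\<exists>w \<in> set H. answer_query w (facts_at E i w) (qs w) = Yes)"
      using True by (auto simp: answer_query_def)
    finally show ?thesis by (simp add: query)
  qed
qed

section \<open>The amortized bound\<close>

definition dirty_pairs :: "nat \<Rightarrow> (nat \<times> nat) set" where
  "dirty_pairs i = {(v, u). v \<in> V \<and> Dirty u \<in> facts_at E i v}"

definition pending_pairs :: "nat \<Rightarrow> nat \<Rightarrow> (nat \<times> nat) set" where
  "pending_pairs i v = {(u, w). Pending u w \<in> facts_at E i v}"

text \<open>The announcements sent in round \<open>Suc i\<close>, at most one for each node.\<close>

definition own_pairs :: "nat \<Rightarrow> (nat \<times> nat) set" where
  "own_pairs i = {(v, u). v \<in> V \<and> (\<exists>s. outgoing (facts_at E i v) = Own u s)}"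

definition changes :: "nat \<Rightarrow> nat set set" where
  "changes i = (E i - E (Suc i)) \<union> (E (Suc i) - E i)"

text \<open>Every inconsistent round is noisy; the converse may fail for lack of a valid
  query.\<close>

definition noisy_rounds :: "nat \<Rightarrow> nat set" where
  "noisy_rounds i = {j \<in> {1..i}. \<exists>v \<in> V. \<not> quiet (facts_at E j v)}"

lemma finite_dirty_pairs: "finite (dirty_pairs i)"
proof (rule finite_subset)
  show "dirty_pairs i \<subseteq> V \<times> V"
    unfolding dirty_pairs_def by (auto dest!: subsetD[OF facts_at_in_facts_over])
qed (simp add: finite_V)

lemma finite_pending_pairs: "finite (pending_pairs i v)"
proof (rule finite_subset)
  show "pending_pairs i v \<subseteq> V \<times> V"
    unfolding pending_pairs_def by (auto dest!: subsetD[OF facts_at_in_facts_over])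
qed (simp add: finite_V)

lemma own_pairs_subset: "own_pairs i \<subseteq> dirty_pairs i"
  using outgoing_OwnD(1) by (auto simp: own_pairs_def dirty_pairs_def)

text \<open>Announcements have priority, so a node with a dirty mark always sends one.\<close>

lemma own_pairs_empty: "own_pairs i = {} \<Longrightarrow> dirty_pairs i = {}"
  unfolding own_pairs_def dirty_pairs_def by (auto dest!: outgoing_Dirty)

lemma finite_changes: "finite (changes i)"
proof (rule finite_subset)
  have "e \<subseteq> V" if e: "e \<in> E j" for e j
  proof -
    obtain u w where "u \<in> V" "w \<in> V" "e = {u, w}"
      using valid e unfolding valid_graph_seq_def by metis
    then show ?thesis by simp
  qed
  then show "changes i \<subseteq> Pow V"
    unfolding changes_def by blast
qed (simp add: finite_V)

lemma num_changes_Suc: "num_changes E (Suc i) = num_changes E i + card (changes i)"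
  by (simp add: num_changes_def changes_def)

text \<open>The factor 2 arises because both ends of a changed edge become dirty.\<close>

lemma card_changed_pairs_le:
  "finite {(v, u). {v, u} \<in> changes i}" "card {(v, u). {v, u} \<in> changes i} \<le> 2 * card (changes i)"
proof -
  let ?P = "\<lambda>e. {(v, u). {v, u} = e}"
  have P: "finite (?P e) \<and> card (?P e) \<le> 2" if e: "e \<in> changes i" for e
  proof -
    obtain u w where "e = {u, w}"
      using e valid unfolding changes_def valid_graph_seq_def by blast
    then have sub: "?P e \<subseteq> {(u, w), (w, u)}"
      by (auto simp: doubleton_eq_iff)
    then have "card (?P e) \<le> card {(u, w), (w, u)}"
      by (intro card_mono) auto
    also have "\<dots> \<le> 2"
      using card_length[of "[(u, w), (w, u)]"] by simp
    finally show ?thesis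
      using finite_subset[OF sub] by simp
  qed
  have eq: "{(v, u). {v, u} \<in> changes i} = (\<Union>e \<in> changes i. ?P e)" by auto
  show "finite {(v, u). {v, u} \<in> changes i}"
    unfolding eq using finite_changes P by blast
  have "card (\<Union>e \<in> changes i. ?P e) \<le> (\<Sum>e \<in> changes i. card (?P e))"
    by (rule card_UN_le[OF finite_changes])
  also have "\<dots> \<le> (\<Sum>e \<in> changes i. 2)"
    using P by (intro sum_mono) blast
  finally show "card {(v, u). {v, u} \<in> changes i} \<le> 2 * card (changes i)"
    unfolding eq by simp
qed

lemma card_dirty_pairs_Suc:
  "card (dirty_pairs (Suc i)) + card (own_pairs i) \<le> card (dirty_pairs i) + 2 * card (changes i)"
proof -
  have "dirty_pairs (Suc i) \<subseteq> (dirty_pairs i - own_pairs i) \<union> {(v, u). {v, u} \<in> changes i}"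
    by (auto simp: dirty_pairs_def own_pairs_def changes_def Dirty_Suc)
  then have "card (dirty_pairs (Suc i))
      \<le> card ((dirty_pairs i - own_pairs i) \<union> {(v, u). {v, u} \<in> changes i})"
    using finite_dirty_pairs card_changed_pairs_le(1) by (intro card_mono) auto
  also have "\<dots> \<le> card (dirty_pairs i - own_pairs i) + 2 * card (changes i)"
    using card_Un_le card_changed_pairs_le(2) by (meson add_left_mono order_trans)
  also have "card (dirty_pairs i - own_pairs i) = card (dirty_pairs i) - card (own_pairs i)"
    by (meson card_Diff_subset finite_dirty_pairs finite_subset own_pairs_subset)
  finally show ?thesis
    using card_mono[OF finite_dirty_pairs own_pairs_subset, of i] by linarith
qed

lemma card_pending_pairs_Suc:
  "card (pending_pairs (Suc i) v) \<le> card (pending_pairs i v) + card (own_pairs i)"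
proof -
  have "pending_pairs (Suc i) v \<subseteq> pending_pairs i v \<union> own_pairs i"
    using edge_in_V by (auto simp: pending_pairs_def own_pairs_def Pending_Suc)
  then have "card (pending_pairs (Suc i) v) \<le> card (pending_pairs i v \<union> own_pairs i)"
    using finite_pending_pairs finite_subset[OF own_pairs_subset finite_dirty_pairs]
    by (intro card_mono) auto
  then show ?thesis
    using card_Un_le order_trans by blast
qed

text \<open>Without announcements nothing joins the queue, and \<open>v\<close>, having no dirty
  mark itself, relays one entry.\<close>

lemma card_pending_pairs_Suc_less:
  assumes "own_pairs i = {}" "v \<in> V" "pending_pairs i v \<noteq> {}"
  shows "card (pending_pairs (Suc i) v) < card (pending_pairs i v)"
proof -
  obtain a b where "Pending a b \<in> facts_at E i v"
    using assms(3) by (auto simp: pending_pairs_def)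
  moreover have "\<forall>u. Dirty u \<notin> facts_at E i v"
    using own_pairs_empty[OF assms(1)] assms(2) by (auto simp: dirty_pairs_def)
  ultimately obtain x y s where xys: "outgoing (facts_at E i v) = Relay x y s"
    using outgoing_Pending by blast
  have no_own: "\<not> ((\<exists>s. outgoing (facts_at E i u) = Own w s) \<and> {u, v} \<in> E (Suc i))" for u w
    using edge_in_V(1)[of u v "Suc i"] assms(1) by (auto simp: own_pairs_def)
  have "pending_pairs (Suc i) v \<subseteq> pending_pairs i v"
    unfolding pending_pairs_def Pending_Suc using no_own by auto
  moreover have "(x, y) \<in> pending_pairs i v"
    using outgoing_RelayD(1)[OF xys] by (simp add: pending_pairs_def)
  moreover have "(x, y) \<notin> pending_pairs (Suc i) v"
    unfolding pending_pairs_def Pending_Suc using no_own xys by auto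
  ultimately show ?thesis
    by (intro psubset_card_mono finite_pending_pairs) blast
qed

text \<open>Each change creates two dirty pairs; announcing one dirty pair lengthens each
  relay queue by at most one, so dirty pairs carry weight two and the longest relay queue weight one.\<close>

lemma potential_bound:
  assumes "v \<in> V"
  shows "card (noisy_rounds i) + 2 * card (dirty_pairs i) + card (pending_pairs i v) \<le> 5 * num_changes E i"
  using assms
proof (induction i arbitrary: v)
  case 0
  then show ?case by (simp add: noisy_rounds_def dirty_pairs_def pending_pairs_def)
next
  case (Suc i)
  note nc = num_changes_Suc[of i]
  have noisy: "noisy_rounds (Suc i) =
      (if \<exists>v \<in> V. \<not> quiet (facts_at E (Suc i) v) then insert (Suc i) (noisy_rounds i) else noisy_rounds i)"
    by (auto simp: noisy_rounds_def le_Suc_eq)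
  have fresh: "finite (noisy_rounds i)" "Suc i \<notin> noisy_rounds i"
    by (auto simp: noisy_rounds_def)
  have le: "card (noisy_rounds (Suc i)) \<le> card (noisy_rounds i) + 1"
    using fresh by (simp add: noisy)
  note IH = Suc.IH[OF Suc.prems]
  note d = card_dirty_pairs_Suc[of i]
  note p = card_pending_pairs_Suc[of i v]
  show ?case
  proof (cases "own_pairs i = {}")
    case False
    then have "card (own_pairs i) \<ge> 1"
      using finite_subset[OF own_pairs_subset finite_dirty_pairs, of i]
      by (metis One_nat_def Suc_leI card_gt_0_iff)
    \<comment> \<open>Each announcement frees weight 2; one unit covers the longer queue, the other
      the round.\<close>
    then show ?thesis
      using IH d p le nc by linarith
  next
    case own: True
    show ?thesis
    proof (cases "changes i = {}")
      case False
      then have "card (changes i) \<ge> 1"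
        using finite_changes[of i] by (metis One_nat_def Suc_leI card_gt_0_iff)
      \<comment> \<open>A change adds weight 4 for its two dirty pairs; the fifth unit pays for the
        round.\<close>
      then show ?thesis
        using IH d p le nc own by simp
    next
      case True
      have dirty: "dirty_pairs (Suc i) = {}"
        using d True own own_pairs_empty[OF own] finite_dirty_pairs[of "Suc i"] by simp
      show ?thesis
      proof (cases "\<exists>w \<in> V. \<not> quiet (facts_at E (Suc i) w)")
        case False
        then have "noisy_rounds (Suc i) = noisy_rounds i"
          by (simp add: noisy)
        then show ?thesis
          using IH p dirty own nc by simp
      next
        case ex: True
        then obtain w where w: "w \<in> V" "pending_pairs (Suc i) w \<noteq> {}"
          using dirty by (auto simp: quiet_def dirty_pairs_def pending_pairs_def)
        show ?thesis
        proof (cases "pending_pairs i v = {}")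
          case False
          then show ?thesis
            using card_pending_pairs_Suc_less[OF own Suc.prems] IH le dirty nc by simp
        next
          case True
          \<comment> \<open>The queue of \<open>v\<close> cannot pay for the round, so the
            hypothesis for \<open>w\<close> is used, whose queue was already nonempty.\<close>
          have "card (pending_pairs i w) \<ge> 1"
            using w card_pending_pairs_Suc[of i w] own finite_pending_pairs[of "Suc i" w]
            by (metis One_nat_def Suc_leI add_0_right card.empty card_gt_0_iff order_less_le_trans)
          then show ?thesis
            using Suc.IH[OF w(1)] True p own le dirty nc by simp
        qed
      qed
    qed
  qed
qed

lemma card_noisy_rounds_le: "card (noisy_rounds i) \<le> 5 * num_changes E i"
proof (cases "\<exists>v. v \<in> V")
  case True
  then obtain v where "v \<in> V" ..
  from potential_bound[OF this, of i] show ?thesis by linarith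
next
  case False
  then have "noisy_rounds i = {}"
    unfolding noisy_rounds_def by blast
  then show ?thesis by simp
qed

lemma num_inconsistent_rounds_cycle_alg:
  assumes "inj_on (enc n) (msgs_over {..<n ^ d})" "V \<subseteq> {..<n ^ d}"
  shows "num_inconsistent_rounds (cycle_alg d enc) k n V E i \<le> 5 * num_changes E i"
proof -
  have "\<not> quiet (facts_at E j v)" if "node_inconsistent (cycle_alg d enc) k n V E j v" for j v
    using that unfolding node_inconsistent_def run_cycle_alg[where enc = enc and n = n and d = d, OF assms]
    by (auto simp: cycle_alg_def decode_encode_facts[OF finite_facts_at] answer_query_def split: if_splits)
  then have "num_inconsistent_rounds (cycle_alg d enc) k n V E i \<le> card (noisy_rounds i)"
    unfolding num_inconsistent_rounds_def noisy_rounds_def by (intro card_mono) auto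
  then show ?thesis
    using card_noisy_rounds_le order_trans by blast
qed

end

theorem theorem4:
  shows "\<forall>k \<in> {4, 5}. \<forall>d. \<exists>(A :: dalg) (c :: real) (B :: real). good_cycle_listing_ds k d A c B"
proof (intro ballI allI)
  fix k d :: nat
  assume k: "k \<in> {4, 5}"
  obtain enc :: "nat \<Rightarrow> msg \<Rightarrow> bool list"
    where inj: "\<And>n. inj_on (enc n) (msgs_over {..<n ^ d})"
      and len: "\<And>n m. n \<ge> 1 \<Longrightarrow> m \<in> msgs_over {..<n ^ d} \<Longrightarrow>
        real (length (enc n m)) \<le> (3 + 4 * real d) * log 2 (real n + 1)"
    using short_encoding_exists[of _ d] by metis
  \<comment> \<open>One algorithm serves both values of \<open>k\<close>; 5 is the constant of the
    potential argument, \<open>3 + 4 * real d\<close> that of the encoding.\<close>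
  have "good_cycle_listing_ds k d (cycle_alg d enc) 5 (3 + 4 * real d)"
    unfolding good_cycle_listing_ds_def
  proof (intro allI impI)
    fix n V E
    assume *: "finite V" "card V = n" and V: "V \<subseteq> {..<n ^ d}" and "valid_graph_seq V E"
    then interpret dynamic_network V E
      by unfold_locales
    note run = run_cycle_alg[where enc = enc and n = n and d = d, OF inj V]
    have "real (length (send (cycle_alg d enc) n u (run (cycle_alg d enc) n E i u)
        (ins_nbrs E i u) (del_nbrs E i u) v)) \<le> (3 + 4 * real d) * log 2 (real n + 1)"
      if "{u, v} \<in> E (Suc i)" for i u v
    proof -
      have "n \<ge> 1"
        using * edge_in_V(1)[OF that] by (auto simp: Suc_le_eq card_gt_0_iff)
      moreover have "outgoing (facts_at E i u) \<in> msgs_over {..<n ^ d}"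
        by (rule outgoing_in_msgs_over[OF order_trans[OF facts_at_in_facts_over facts_over_mono[OF V]]])
      ultimately show ?thesis
        unfolding run using len
        by (simp add: cycle_alg_def decode_encode_facts[OF finite_facts_at])
    qed
    moreover have "real (num_inconsistent_rounds (cycle_alg d enc) k n V E i) \<le> 5 * real (num_changes E i)" for i
      using num_inconsistent_rounds_cycle_alg[where enc = enc and n = n and d = d, OF inj V, of k i] by linarith
    ultimately show "(\<forall>i u v. {u, v} \<in> E (Suc i) \<longrightarrow>
          real (length (send (cycle_alg d enc) n u (run (cycle_alg d enc) n E i u)
            (ins_nbrs E i u) (del_nbrs E i u) v)) \<le> (3 + 4 * real d) * log 2 (real n + 1)) \<and>
        (\<forall>i \<ge> 1. listing_correct (cycle_alg d enc) k n V E i) \<and>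
        (\<forall>i. real (num_inconsistent_rounds (cycle_alg d enc) k n V E i) \<le> 5 * real (num_changes E i))"
      using listing_correct_cycle_alg[where enc = enc and n = n and d = d, OF inj V k] by blast
  qed
  then show "\<exists>A c B. good_cycle_listing_ds k d A c B" by blast
qed

end
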